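(* Let $n\ge 0$ and $p\ge 1$ be integers and let $\mathbf{x}=(x_1,\ldots,x_p)$ be a vector of indeterminates. Let $\Delta(n,p,\mathbf{x})=\det_{\boldsymbol{\alpha},\boldsymbol{\beta}\in C(n,p)}\left((\mathbf{x}+\boldsymbol{\alpha})^{\boldsymbol{\beta}}\right)$ be the determinant of the square matrix whose rows and columns are indexed by the $p$-compositions of $n$ (in the same order) and whose $(\boldsymbol{\alpha},\boldsymbol{\beta})$ entry is $(\mathbf{x}+\boldsymbol{\alpha})^{\boldsymbol{\beta}}$. Then, as polynomials in $x_1,\ldots,x_p$, $$\Delta(n,p,\mathbf{x})=(s(\mathbf{x})+n)^{\binom{n+p-1}{p}}\prod_{i=1}^{n} i^{(p-1)\binom{n+p-i-1}{p-1}},$$ where $s(\mathbf{x})=x_1+\cdots+x_p$.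
   Context: $C(n,p)$ denotes the set of $p$-compositions of $n$, i.e. the set of $p$-tuples $\boldsymbol{\alpha}=(\alpha_1,\ldots,\alpha_p)$ of nonnegative integers with $\alpha_1+\cdots+\alpha_p=n$. For $\boldsymbol{\alpha},\boldsymbol{\beta}\in C(n,p)$, $(\mathbf{x}+\boldsymbol{\alpha})^{\boldsymbol{\beta}}=(x_1+\alpha_1)^{\beta_1}\cdots(x_p+\alpha_p)^{\beta_p}$. The convention $0^0=1$ is used and empty products equal $1$. *)

theory Defs
  imports "Jordan_Normal_Form.Determinant" "HOL-Library.Poly_Mapping"
begin

definition compositions :: "nat \<Rightarrow> nat \<Rightarrow> nat list set" where
  "compositions n p = {\<alpha>. length \<alpha> = p \<and> sum_list \<alpha> = n}"

lemma finite_compositions: "finite (compositions n p)"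
proof (rule finite_subset)
  show "compositions n p \<subseteq> {\<alpha>. set \<alpha> \<subseteq> {..n} \<and> length \<alpha> = p}"
    by (auto simp: compositions_def intro: member_le_sum_list)
  show "finite {\<alpha>. set \<alpha> \<subseteq> {..n} \<and> length \<alpha> = p}"
    by (rule finite_lists_length_eq) simp
qed

text \<open>Polynomials with integer coefficients in countably many indeterminates: a monomial is
  a finitely supported exponent function, and a polynomial is a finitely supported coefficient
  function on monomials. The identities of interest involve only the indeterminates
  with index below \<open>p\<close>; components of vectors are counted from 0.\<close>

type_synonym int_mpoly = "(nat \<Rightarrow>\<^sub>0 nat) \<Rightarrow>\<^sub>0 int"

definition Var :: "nat \<Rightarrow> int_mpoly" where
  "Var i = Poly_Mapping.single (Poly_Mapping.single i 1) 1"

definition shifted_power :: "nat \<Rightarrow> (nat \<Rightarrow> 'a) \<Rightarrow> nat list \<Rightarrow> nat list \<Rightarrow> 'a::comm_ring_1" where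
  "shifted_power p x \<alpha> \<beta> = (\<Prod>i<p. (x i + of_nat (\<alpha> ! i)) ^ (\<beta> ! i))"

text \<open>The list \<open>cs\<close> fixes the common order of the rows and columns; it is meant to enumerate
  \<open>compositions n p\<close> without repetition.\<close>

definition Delta :: "nat list list \<Rightarrow> nat \<Rightarrow> (nat \<Rightarrow> 'a) \<Rightarrow> 'a::comm_ring_1" where
  "Delta cs p x =
     det (mat (length cs) (length cs) (\<lambda>(i, j). shifted_power p x (cs ! i) (cs ! j)))"

lemma ex_enumeration_compositions: "\<exists>cs. distinct cs \<and> set cs = compositions n p"
  using finite_distinct_list[OF finite_compositions] by blast

end

theory Submission
  imports Defs
begin

text \<open>
  Write \<open>p = q + 1\<close>. All evaluation points \<open>x + \<alpha>\<close> lie on the hyperplane where the sum of the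
  coordinates is \<open>t = s(x) + n\<close>. On a hyperplane, homogeneous polynomials of degree \<open>n\<close> in \<open>p\<close>
  variables are the same thing as arbitrary polynomials of degree at most \<open>n\<close> in the first \<open>q\<close>
  variables, and evaluating these on a simplex grid gives a triangular matrix in Newton's basis
  of falling factorials. This is carried out by changing the family of functions that labels the
  columns, keeping track of the determinant:

  \<^item> The last variable is replaced by the sum \<open>\<sigma>\<close> of all variables. Expanding \<open>\<sigma>\<close> shows that the
    product of \<open>\<sigma> ^ \<beta>\<^sub>q\<close> with the power product in the first \<open>q\<close> variables differs from the
    original monomial by monomials with a smaller last exponent
    (\<open>sum_power_expansion\<close>), so the determinant is unchanged.
  \<^item> On the hyperplane \<open>\<sigma>\<close> is the constant \<open>t\<close>, so column \<open>\<beta>\<close> has the factor \<open>t ^ \<beta>\<^sub>q\<close>. This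
    yields the power of \<open>t\<close> in the result.
  \<^item> The remaining monomials in \<open>x\<^sub>i + \<alpha>\<^sub>i\<close>, \<open>i < q\<close>, are replaced by products of falling
    factorials of the integers \<open>\<alpha>\<^sub>i\<close>. This is again a unitriangular change
    (\<open>newton_expansion\<close>), now with respect to the total degree in the first \<open>q\<close> variables.
  \<^item> A product of falling factorials with exponents \<open>\<beta>\<close> vanishes at \<open>\<alpha>\<close> unless \<open>\<beta>\<^sub>i \<le> \<alpha>\<^sub>i\<close> for
    all \<open>i < q\<close>. The matrix is therefore triangular, with diagonal entries \<open>\<Prod>i<q. \<alpha>\<^sub>i!\<close>.

  It remains to compute \<open>\<Sum>\<alpha>. \<alpha>\<^sub>q\<close> and \<open>\<Prod>\<alpha>. \<alpha>\<^sub>i!\<close>, both of which reduce to counting the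
  compositions whose \<open>i\<close>-th part is at least \<open>j\<close>; subtracting \<open>j\<close> from that part shows that there are
  as many of them as compositions of \<open>n - j\<close>. No division takes place, so the argument works over
  every commutative ring.
\<close>

section \<open>Determinants with rows and columns indexed by a list\<close>

text \<open>A column label \<open>b\<close> carries the function \<open>f b\<close> of the row label. Taking the column label as
  first argument makes a change of columns a statement about linear combinations of functions.\<close>

definition family_det :: "'b list \<Rightarrow> ('b \<Rightarrow> 'b \<Rightarrow> 'a) \<Rightarrow> 'a::comm_ring_1" where
  "family_det cs f = det (mat (length cs) (length cs) (\<lambda>(i, j). f (cs ! j) (cs ! i)))"

lemma family_det_cong:
  assumes "\<And>a b. a \<in> set cs \<Longrightarrow> b \<in> set cs \<Longrightarrow> f b a = g b a"
  shows "family_det cs f = family_det cs g"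
  unfolding family_det_def by (intro arg_cong[where f = det] eq_matI) (auto simp: assms)

lemma sum_nth_distinct:
  assumes "distinct cs"
  shows "(\<Sum>k<length cs. h (cs ! k)) = sum h (set cs)"
  by (rule sum.reindex_bij_betw[OF bij_betw_nth[OF assms refl refl]])

lemma prod_nth_distinct:
  assumes "distinct cs"
  shows "(\<Prod>k<length cs. h (cs ! k)) = prod h (set cs)"
  by (rule prod.reindex_bij_betw[OF bij_betw_nth[OF assms refl refl]])

lemma family_det_mult:
  assumes "distinct cs"
  shows "family_det cs (\<lambda>b a. \<Sum>c\<in>set cs. f c a * g b c) = family_det cs f * family_det cs g"
proof -
  let ?n = "length cs"
  let ?F = "mat ?n ?n (\<lambda>(i, j). f (cs ! j) (cs ! i))"
  let ?G = "mat ?n ?n (\<lambda>(i, j). g (cs ! j) (cs ! i))"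
  have "mat ?n ?n (\<lambda>(i, j). \<Sum>c\<in>set cs. f c (cs ! i) * g (cs ! j) c) = ?F * ?G"
    by (rule eq_matI)
      (auto simp: scalar_prod_def sum_nth_distinct[OF assms, symmetric] atLeast0LessThan)
  then show ?thesis
    unfolding family_det_def by (simp add: det_mult[of _ ?n])
qed

text \<open>In the Leibniz expansion, a permutation with nonzero contribution increases the rank at every
  index that it moves. As a permutation preserves the sum of all ranks, it moves none.\<close>

lemma family_det_triangular:
  fixes f :: "'b \<Rightarrow> 'b \<Rightarrow> 'a::comm_ring_1" and r :: "'b \<Rightarrow> nat"
  assumes dist: "distinct cs"
    and tri: "\<And>a b. a \<in> set cs \<Longrightarrow> b \<in> set cs \<Longrightarrow> f b a \<noteq> 0 \<Longrightarrow> a = b \<or> r a < r b"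
  shows "family_det cs f = (\<Prod>a\<in>set cs. f a a)"
proof -
  let ?n = "length cs"
  let ?A = "mat ?n ?n (\<lambda>(i, j). f (cs ! j) (cs ! i))"
  have zero: "(\<Prod>i = 0..<?n. ?A $$ (i, \<pi> i)) = 0" if \<pi>: "\<pi> permutes {0..<?n}" "\<pi> \<noteq> id" for \<pi>
  proof (rule ccontr)
    assume nz: "(\<Prod>i = 0..<?n. ?A $$ (i, \<pi> i)) \<noteq> 0"
    have lt: "\<pi> i < ?n" if "i < ?n" for i
      using permutes_in_image[OF \<pi>(1), of i] that by simp
    have step: "cs ! i = cs ! \<pi> i \<or> r (cs ! i) < r (cs ! \<pi> i)" if i: "i < ?n" for i
    proof -
      have "?A $$ (i, \<pi> i) \<noteq> 0"
      proof
        assume "?A $$ (i, \<pi> i) = 0"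
        with i have "\<exists>k\<in>{0..<?n}. ?A $$ (k, \<pi> k) = 0"
          by (intro bexI[of _ i]) simp_all
        then have "(\<Prod>i = 0..<?n. ?A $$ (i, \<pi> i)) = 0"
          by (rule prod_zero[OF finite_atLeastLessThan])
        with nz show False by contradiction
      qed
      then show ?thesis using i lt[OF i] tri by auto
    qed
    obtain i where i: "\<pi> i \<noteq> i" using \<pi>(2) by (metis eq_id_iff)
    then have i_lt: "i < ?n" using permutes_not_in[OF \<pi>(1), of i] by force
    then have "r (cs ! i) < r (cs ! \<pi> i)"
      using step[OF i_lt] i lt[OF i_lt] dist by (auto simp: nth_eq_iff_index_eq)
    then have "(\<Sum>k\<in>{0..<?n}. r (cs ! k)) < (\<Sum>k\<in>{0..<?n}. r (cs ! \<pi> k))"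
      using step i_lt by (intro sum_strict_mono_ex1) (fastforce intro: less_imp_le)+
    moreover have "(\<Sum>k\<in>{0..<?n}. r (cs ! \<pi> k)) = (\<Sum>k\<in>{0..<?n}. r (cs ! k))"
      using sum.permute[OF \<pi>(1), of "\<lambda>k. r (cs ! k)"] by (simp add: o_def)
    ultimately show False by simp
  qed
  have "det ?A = (\<Sum>\<pi>\<in>{\<pi>. \<pi> permutes {0..<?n}}. signof \<pi> * (\<Prod>i = 0..<?n. ?A $$ (i, \<pi> i)))"
    by (rule det_def') simp
  also have "\<dots> = (\<Sum>\<pi>\<in>{id}. signof \<pi> * (\<Prod>i = 0..<?n. ?A $$ (i, \<pi> i)))"
    by (rule sum.mono_neutral_right)
      (use zero in \<open>auto simp: finite_permutations permutes_id[unfolded id_def] permutes_id simp del: index_mat\<close>)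
  also have "\<dots> = (\<Prod>i<?n. f (cs ! i) (cs ! i))"
    by (simp add: atLeast0LessThan)
  also have "\<dots> = (\<Prod>a\<in>set cs. f a a)"
    by (rule prod_nth_distinct[OF dist])
  finally show ?thesis unfolding family_det_def .
qed

lemma family_det_scale_columns:
  assumes "distinct cs"
  shows "family_det cs (\<lambda>b a. d b * f b a) = (\<Prod>b\<in>set cs. d b) * family_det cs f"
proof -
  have "family_det cs (\<lambda>b a. d b * f b a) =
      family_det cs (\<lambda>b a. \<Sum>c\<in>set cs. f c a * (if c = b then d b else 0))"
    by (rule family_det_cong) (simp add: if_distrib[of "\<lambda>y. _ * y"] sum.delta mult.commute cong: if_cong)
  also have "\<dots> = family_det cs f * family_det cs (\<lambda>b c. if c = b then d b else 0)"
    by (rule family_det_mult[OF assms])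
  \<comment> \<open>A diagonal matrix is triangular even for a constant rank.\<close>
  also have "family_det cs (\<lambda>b c. if c = b then d b else 0) = (\<Prod>b\<in>set cs. d b)"
    by (subst family_det_triangular[OF assms, where r = "\<lambda>_. 0"]) (auto split: if_splits)
  finally show ?thesis by (simp add: mult.commute)
qed

section \<open>Unitriangular changes of columns\<close>

definition lin_comb :: "'b set \<Rightarrow> ('b \<Rightarrow> 'c \<Rightarrow> 'a) \<Rightarrow> ('c \<Rightarrow> 'a::comm_ring_1) \<Rightarrow> bool" where
  "lin_comb B f g \<longleftrightarrow> (\<exists>u. \<forall>a. g a = (\<Sum>b\<in>B. u b * f b a))"

lemma lin_comb_zero: "lin_comb B f (\<lambda>a. 0)"
  unfolding lin_comb_def by (rule exI[of _ "\<lambda>_. 0"]) simp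

lemma lin_comb_add:
  assumes "lin_comb B f g" "lin_comb B f h"
  shows "lin_comb B f (\<lambda>a. g a + h a)"
proof -
  obtain u v where "\<forall>a. g a = (\<Sum>b\<in>B. u b * f b a)" "\<forall>a. h a = (\<Sum>b\<in>B. v b * f b a)"
    using assms unfolding lin_comb_def by blast
  then show ?thesis
    unfolding lin_comb_def
    by (intro exI[of _ "\<lambda>b. u b + v b"]) (simp add: distrib_right sum.distrib)
qed

lemma lin_comb_scale:
  assumes "lin_comb B f g"
  shows "lin_comb B f (\<lambda>a. w * g a)"
proof -
  obtain u where "\<forall>a. g a = (\<Sum>b\<in>B. u b * f b a)"
    using assms unfolding lin_comb_def by blast
  then show ?thesis
    unfolding lin_comb_def
    by (intro exI[of _ "\<lambda>b. w * u b"]) (simp add: sum_distrib_left mult.assoc)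
qed

lemma lin_comb_sum:
  assumes "\<And>i. i \<in> I \<Longrightarrow> lin_comb B f (g i)"
  shows "lin_comb B f (\<lambda>a. \<Sum>i\<in>I. g i a)"
  using assms
proof (induction I rule: infinite_finite_induct)
  case (insert i I)
  then show ?case using lin_comb_add[of B f "g i" "\<lambda>a. \<Sum>i\<in>I. g i a"] by simp
qed (simp_all add: lin_comb_zero)

lemma lin_comb_base:
  assumes "finite B" "b \<in> B"
  shows "lin_comb B f (f b)"
  unfolding lin_comb_def using assms
  by (intro exI[of _ "\<lambda>c. if c = b then 1 else 0"])
    (simp add: if_distrib[of "\<lambda>y. y * _"] sum.delta cong: if_cong)

lemma lin_comb_mono:
  assumes "lin_comb B f g" "B \<subseteq> C" "finite C"
  shows "lin_comb C f g"
proof -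
  obtain u where u: "\<forall>a. g a = (\<Sum>b\<in>B. u b * f b a)"
    using assms unfolding lin_comb_def by blast
  have "g a = (\<Sum>b\<in>C. (if b \<in> B then u b else 0) * f b a)" for a
    unfolding u[rule_format] using assms by (intro sum.mono_neutral_cong_left) auto
  then show ?thesis
    unfolding lin_comb_def by (intro exI[of _ "\<lambda>b. if b \<in> B then u b else 0"] allI)
qed

lemma lin_comb_mult:
  assumes "lin_comb B f g" "\<And>b. b \<in> B \<Longrightarrow> lin_comb C f (\<lambda>a. h a * f b a)"
  shows "lin_comb C f (\<lambda>a. h a * g a)"
proof -
  obtain u where u: "\<forall>a. g a = (\<Sum>b\<in>B. u b * f b a)"
    using assms unfolding lin_comb_def by blast
  have "lin_comb C f (\<lambda>a. \<Sum>b\<in>B. u b * (h a * f b a))"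
    by (intro lin_comb_sum lin_comb_scale assms(2))
  moreover have "h a * g a = (\<Sum>b\<in>B. u b * (h a * f b a))" for a
    by (simp add: u sum_distrib_left mult_ac)
  ultimately show ?thesis by simp
qed

text \<open>Adding to each column combinations of columns of smaller rank multiplies the matrix by a
  unitriangular one.\<close>

lemma family_det_unitriangular_change:
  fixes f g :: "'b \<Rightarrow> 'b \<Rightarrow> 'a::comm_ring_1" and r :: "'b \<Rightarrow> nat"
  assumes dist: "distinct cs"
    and change: "\<And>b. b \<in> set cs \<Longrightarrow> lin_comb {c \<in> set cs. r c < r b} f (\<lambda>a. g b a - f b a)"
  shows "family_det cs g = family_det cs f"
proof -
  obtain u where u: "\<And>b a. b \<in> set cs \<Longrightarrow>
      g b a - f b a = (\<Sum>c\<in>{c \<in> set cs. r c < r b}. u b c * f c a)"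
    using change unfolding lin_comb_def by metis
  define T where "T b c = (if c = b then 1 else if r c < r b then u b c else 0)" for b c
  have "family_det cs g = family_det cs (\<lambda>b a. \<Sum>c\<in>set cs. f c a * T b c)"
  proof (rule family_det_cong)
    fix a b assume b: "b \<in> set cs"
    have "(\<Sum>c\<in>set cs. f c a * T b c) =
        f b a + (\<Sum>c\<in>set cs - {b}. f c a * T b c)"
      using b by (simp add: sum.remove[of _ b] T_def)
    also have "(\<Sum>c\<in>set cs - {b}. f c a * T b c) = (\<Sum>c\<in>{c \<in> set cs. r c < r b}. u b c * f c a)"
      by (rule sum.mono_neutral_cong_right) (auto simp: T_def mult.commute)
    also have "f b a + \<dots> = g b a"
      by (simp add: u[OF b, symmetric])
    finally show "g b a = (\<Sum>c\<in>set cs. f c a * T b c)" ..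
  qed
  also have "\<dots> = family_det cs f * family_det cs T"
    by (rule family_det_mult[OF dist])
  also have "family_det cs T = (\<Prod>a\<in>set cs. T a a)"
    by (rule family_det_triangular[OF dist, where r = r]) (auto simp: T_def split: if_splits)
  finally show ?thesis by (simp add: T_def)
qed

section \<open>From the last variable to the sum of all variables\<close>

lemma mem_compositions: "\<alpha> \<in> compositions n p \<longleftrightarrow> length \<alpha> = p \<and> (\<Sum>i<p. \<alpha> ! i) = n"
  by (auto simp: compositions_def sum_list_sum_nth atLeast0LessThan)

lemma compositions_nth_le:
  assumes "\<alpha> \<in> compositions n p" "i < p"
  shows "\<alpha> ! i \<le> n"
  using assms by (auto simp: compositions_def intro: elem_le_sum_list)

lemma prod_nth_update:
  fixes h :: "nat \<Rightarrow> 'b \<Rightarrow> 'a::comm_monoid_mult"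
  assumes "i < m" "m \<le> length \<beta>"
  shows "(\<Prod>k<m. h k (\<beta>[i := v] ! k)) = h i v * (\<Prod>k\<in>{..<m} - {i}. h k (\<beta> ! k))"
proof -
  have "(\<Prod>k<m. h k (\<beta>[i := v] ! k)) =
      h i (\<beta>[i := v] ! i) * (\<Prod>k\<in>{..<m} - {i}. h k (\<beta>[i := v] ! k))"
    by (rule prod.remove[of "{..<m}" i]) (use assms in auto)
  also have "(\<Prod>k\<in>{..<m} - {i}. h k (\<beta>[i := v] ! k)) = (\<Prod>k\<in>{..<m} - {i}. h k (\<beta> ! k))"
    by (rule prod.cong) auto
  finally show ?thesis using assms by simp
qed

lemma prod_nth_remove:
  fixes h :: "nat \<Rightarrow> 'b \<Rightarrow> 'a::comm_monoid_mult"
  assumes "i < m"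
  shows "(\<Prod>k<m. h k (\<beta> ! k)) = h i (\<beta> ! i) * (\<Prod>k\<in>{..<m} - {i}. h k (\<beta> ! k))"
  by (rule prod.remove[of "{..<m}" i]) (use assms in auto)

lemma shifted_power_Suc_exponent:
  assumes "i < m" "m \<le> length \<beta>"
  shows "shifted_power m x \<alpha> (\<beta>[i := Suc (\<beta> ! i)]) =
    (x i + of_nat (\<alpha> ! i)) * shifted_power m x \<alpha> \<beta>"
  unfolding shifted_power_def
    prod_nth_update[OF assms, of "\<lambda>k e. (x k + of_nat (\<alpha> ! k)) ^ e"]
    prod_nth_remove[OF assms(1), of "\<lambda>k e. (x k + of_nat (\<alpha> ! k)) ^ e" \<beta>]
  by (simp add: mult.assoc)

text \<open>Expanding one factor of the power of the sum of all variables, only the choice of the last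
  variable raises the last exponent; hence the induction on the power \<open>k\<close>.\<close>

lemma sum_power_expansion:
  fixes x :: "nat \<Rightarrow> 'a::comm_ring_1"
  assumes "length \<beta> = Suc q" "k + sum_list \<beta> = n"
  shows "lin_comb {\<gamma> \<in> compositions n (Suc q). \<gamma> ! q < \<beta> ! q + k}
      (\<lambda>\<gamma> \<alpha>. shifted_power (Suc q) x \<alpha> \<gamma>)
      (\<lambda>\<alpha>. (\<Sum>i<Suc q. x i + of_nat (\<alpha> ! i)) ^ k * shifted_power (Suc q) x \<alpha> \<beta>
        - shifted_power (Suc q) x \<alpha> (\<beta>[q := \<beta> ! q + k]))"
  using assms
proof (induction k arbitrary: \<beta>)
  case 0
  have "\<beta>[q := \<beta> ! q + 0] = \<beta>" by simp
  then show ?case by (simp add: lin_comb_zero)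
next
  case (Suc k)
  let ?M = "\<lambda>\<gamma> \<alpha>. shifted_power (Suc q) x \<alpha> \<gamma>"
  let ?s = "\<lambda>\<alpha>. \<Sum>i<Suc q. x i + of_nat (\<alpha> ! i)"
  let ?B = "{\<gamma> \<in> compositions n (Suc q). \<gamma> ! q < \<beta> ! q + Suc k}"
  let ?inc = "\<lambda>i. \<beta>[i := Suc (\<beta> ! i)]"
  have fin: "finite ?B" using finite_compositions by simp
  have len: "length (?inc i) = Suc q" for i using Suc.prems by simp
  have sum: "k + sum_list (?inc i) = n" if "i < Suc q" for i
    using Suc.prems that by (simp add: sum_list_update)
  have last: "lin_comb ?B ?M (\<lambda>\<alpha>. ?s \<alpha> ^ k * ?M (?inc q) \<alpha> - ?M (\<beta>[q := \<beta> ! q + Suc k]) \<alpha>)"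
    using Suc.IH[OF len sum, of q] Suc.prems by simp
  have other: "lin_comb ?B ?M (\<lambda>\<alpha>. ?s \<alpha> ^ k * ?M (?inc i) \<alpha>)" if i: "i < q" for i
  proof -
    let ?\<delta> = "(?inc i)[q := ?inc i ! q + k]"
    have q: "?inc i ! q = \<beta> ! q" using i by simp
    have \<delta>: "?\<delta> \<in> ?B"
      using sum[of i] i Suc.prems by (simp add: compositions_def sum_list_update)
    have "lin_comb ?B ?M (\<lambda>\<alpha>. ?s \<alpha> ^ k * ?M (?inc i) \<alpha> - ?M ?\<delta> \<alpha>)"
      using i by (intro lin_comb_mono[OF Suc.IH[OF len sum] _ fin]) (auto simp: q)
    from lin_comb_add[OF this lin_comb_base[OF fin \<delta>, of ?M]] show ?thesis by simp
  qed
  have "lin_comb ?B ?M (\<lambda>\<alpha>. (\<Sum>i<q. ?s \<alpha> ^ k * ?M (?inc i) \<alpha>) +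
      (?s \<alpha> ^ k * ?M (?inc q) \<alpha> - ?M (\<beta>[q := \<beta> ! q + Suc k]) \<alpha>))"
    by (intro lin_comb_add lin_comb_sum other last) simp
  moreover have "?s \<alpha> ^ Suc k * ?M \<beta> \<alpha> = (\<Sum>i<Suc q. ?s \<alpha> ^ k * ?M (?inc i) \<alpha>)" for \<alpha>
  proof -
    have "?s \<alpha> ^ Suc k * ?M \<beta> \<alpha> = ?s \<alpha> ^ k * (\<Sum>i<Suc q. (x i + of_nat (\<alpha> ! i)) * ?M \<beta> \<alpha>)"
      by (simp only: power_Suc2 mult.assoc sum_distrib_right)
    also have "(\<Sum>i<Suc q. (x i + of_nat (\<alpha> ! i)) * ?M \<beta> \<alpha>) = (\<Sum>i<Suc q. ?M (?inc i) \<alpha>)"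
      using Suc.prems by (intro sum.cong refl) (simp add: shifted_power_Suc_exponent)
    finally show ?thesis by (simp only: sum_distrib_left)
  qed
  ultimately show ?case by (simp add: add_diff_eq)
qed

text \<open>Applied to lists of length \<open>q + 1\<close>, \<open>shifted_power q\<close> reads only the first \<open>q\<close> parts and so is
  the power product without the last variable.\<close>

lemma shifted_power_drop_last:
  "length \<beta> = Suc q \<Longrightarrow> shifted_power (Suc q) x \<alpha> (\<beta>[q := 0]) = shifted_power q x \<alpha> \<beta>"
  by (simp add: shifted_power_def)

lemma family_det_sum_of_variables:
  fixes x :: "nat \<Rightarrow> 'a::comm_ring_1"
  assumes dist: "distinct cs" and cs: "set cs = compositions n (Suc q)"
  shows "family_det cs (\<lambda>\<beta> \<alpha>. shifted_power (Suc q) x \<alpha> \<beta>) =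
    family_det cs (\<lambda>\<beta> \<alpha>. (\<Sum>i<Suc q. x i + of_nat (\<alpha> ! i)) ^ (\<beta> ! q) * shifted_power q x \<alpha> \<beta>)"
proof (rule family_det_unitriangular_change[symmetric, OF dist, where r = "\<lambda>\<beta>. \<beta> ! q"])
  fix \<beta> assume "\<beta> \<in> set cs"
  then have len: "length \<beta> = Suc q" and sum: "\<beta> ! q + sum_list (\<beta>[q := 0]) = n"
    using cs elem_le_sum_list[of q \<beta>] by (auto simp: compositions_def sum_list_update)
  show "lin_comb {\<gamma> \<in> set cs. \<gamma> ! q < \<beta> ! q} (\<lambda>\<beta> \<alpha>. shifted_power (Suc q) x \<alpha> \<beta>)
      (\<lambda>\<alpha>. (\<Sum>i<Suc q. x i + of_nat (\<alpha> ! i)) ^ (\<beta> ! q) * shifted_power q x \<alpha> \<beta>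
        - shifted_power (Suc q) x \<alpha> \<beta>)"
    using sum_power_expansion[of "\<beta>[q := 0]", OF _ sum, of q x] len
    unfolding shifted_power_drop_last[OF len] by (simp add: cs)
qed

section \<open>From power products to falling factorials\<close>

definition falling_product :: "nat \<Rightarrow> nat list \<Rightarrow> nat list \<Rightarrow> 'a::comm_ring_1" where
  "falling_product q \<alpha> \<beta> = (\<Prod>i<q. \<Prod>k<\<beta> ! i. of_nat (\<alpha> ! i) - of_nat k)"

lemma falling_product_Suc_exponent:
  assumes "i < m" "m \<le> length \<beta>"
  shows "falling_product m \<alpha> (\<beta>[i := Suc (\<beta> ! i)]) =
    (of_nat (\<alpha> ! i) - of_nat (\<beta> ! i)) * falling_product m \<alpha> \<beta>"
  unfolding falling_product_def
    prod_nth_update[OF assms, of "\<lambda>j e. \<Prod>k<e. of_nat (\<alpha> ! j) - of_nat k"]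
    prod_nth_remove[OF assms(1), of "\<lambda>j e. \<Prod>k<e. of_nat (\<alpha> ! j) - of_nat k" \<beta>]
  by (simp add: mult_ac)

text \<open>Newton's rule \<open>(x + a) (a)\<^sub>k = (a)\<^sub>k\<^sub>+\<^sub>1 + (x + k) (a)\<^sub>k\<close>, where \<open>(a)\<^sub>k\<close> is the falling factorial.
  The unit added to one exponent is taken from the last part, which stays a
  composition of \<open>n\<close> and does not affect the product.\<close>

lemma mult_falling_product:
  fixes x :: "nat \<Rightarrow> 'a::comm_ring_1"
  assumes "i < q" "length \<gamma> = Suc q"
  shows "(x i + of_nat (\<alpha> ! i)) * falling_product q \<alpha> \<gamma> =
    falling_product q \<alpha> (\<gamma>[i := Suc (\<gamma> ! i), q := v])
      + (x i + of_nat (\<gamma> ! i)) * falling_product q \<alpha> \<gamma>"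
proof -
  have "falling_product q \<alpha> (\<gamma>[i := Suc (\<gamma> ! i), q := v]) =
      (falling_product q \<alpha> (\<gamma>[i := Suc (\<gamma> ! i)]) :: 'a)"
    by (simp add: falling_product_def)
  also have "\<dots> = (of_nat (\<alpha> ! i) - of_nat (\<gamma> ! i)) * falling_product q \<alpha> \<gamma>"
    using assms by (intro falling_product_Suc_exponent) auto
  finally show ?thesis by (simp add: algebra_simps)
qed

lemma compositions_move_unit:
  assumes "\<gamma> \<in> compositions n p" "i < p" "j < p" "i \<noteq> j" "\<gamma> ! j > 0"
  shows "\<gamma>[i := Suc (\<gamma> ! i), j := \<gamma> ! j - 1] \<in> compositions n p"
  using assms elem_le_sum_list[of j \<gamma>]
  by (auto simp: compositions_def sum_list_update)

text \<open>The last part of a composition of \<open>n\<close> is \<open>n\<close> minus the degree in the first \<open>q\<close> variables, so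
  terms of lower degree are the ones with a larger last part. The induction is on this degree.\<close>

lemma newton_expansion:
  fixes x :: "nat \<Rightarrow> 'a::comm_ring_1"
  assumes "\<beta> \<in> compositions n (Suc q)"
  shows "lin_comb {\<gamma> \<in> compositions n (Suc q). \<beta> ! q < \<gamma> ! q} (\<lambda>\<gamma> \<alpha>. falling_product q \<alpha> \<gamma>)
    (\<lambda>\<alpha>. shifted_power q x \<alpha> \<beta> - falling_product q \<alpha> \<beta>)"
  using assms
proof (induction "n - \<beta> ! q" arbitrary: \<beta> rule: less_induct)
  case less
  let ?F = "\<lambda>\<gamma> \<alpha>. falling_product q \<alpha> \<gamma> :: 'a"
  let ?P = "\<lambda>\<gamma> \<alpha>. shifted_power q x \<alpha> \<gamma>"
  let ?B = "\<lambda>b. {\<gamma> \<in> compositions n (Suc q). b < \<gamma> ! q}"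
  have fin: "finite (?B b)" for b using finite_compositions by simp
  show ?case
  proof (cases "\<exists>i<q. \<beta> ! i > 0")
    case False
    then have "?P \<beta> \<alpha> - ?F \<beta> \<alpha> = 0" for \<alpha>
      by (simp add: shifted_power_def falling_product_def)
    then show ?thesis by (simp add: lin_comb_zero)
  next
    case True
    then obtain i where i: "i < q" "\<beta> ! i > 0" by blast
    have len: "length \<beta> = Suc q" using less.prems by (simp add: compositions_def)
    let ?y = "\<lambda>\<alpha>. x i + of_nat (\<alpha> ! i) :: 'a"
    \<comment> \<open>Split off one factor \<open>x\<^sub>i + \<alpha>\<^sub>i\<close>, expand the rest, and multiply back by Newton's rule; each
      application of the rule lowers the last part by at most one.\<close>
    define \<beta>' where "\<beta>' = \<beta>[q := Suc (\<beta> ! q), i := \<beta> ! i - 1]"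
    have mem: "\<beta>' \<in> compositions n (Suc q)"
      unfolding \<beta>'_def using compositions_move_unit[OF less.prems, of q i] i by simp
    have len': "length \<beta>' = Suc q" and last: "\<beta>' ! q = Suc (\<beta> ! q)" and nth_i: "\<beta>' ! i = \<beta> ! i - 1"
      using len i by (simp_all add: \<beta>'_def)
    have undo: "\<beta>'[i := Suc (\<beta>' ! i), q := \<beta> ! q] = \<beta>"
      using len i by (intro nth_equalityI) (auto simp: \<beta>'_def nth_list_update)
    have IH: "lin_comb (?B (Suc (\<beta> ! q))) ?F (\<lambda>\<alpha>. ?P \<beta>' \<alpha> - ?F \<beta>' \<alpha>)"
      using less.hyps[OF _ mem] compositions_nth_le[OF mem, of q] unfolding last by simp
    have "lin_comb (?B (\<beta> ! q)) ?F (\<lambda>\<alpha>. ?y \<alpha> * (?P \<beta>' \<alpha> - ?F \<beta>' \<alpha>))"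
    proof (rule lin_comb_mult[OF IH])
      fix \<gamma> assume \<gamma>: "\<gamma> \<in> ?B (Suc (\<beta> ! q))"
      let ?\<delta> = "\<gamma>[i := Suc (\<gamma> ! i), q := \<gamma> ! q - 1]"
      have len_\<gamma>: "length \<gamma> = Suc q" using \<gamma> by (simp add: compositions_def)
      have "?\<delta> \<in> compositions n (Suc q)"
        using \<gamma> i by (intro compositions_move_unit) auto
      then have "?\<delta> \<in> ?B (\<beta> ! q)" using \<gamma> len_\<gamma> by auto
      moreover have "\<gamma> \<in> ?B (\<beta> ! q)" using \<gamma> by auto
      ultimately have "lin_comb (?B (\<beta> ! q)) ?F (\<lambda>\<alpha>. ?F ?\<delta> \<alpha> + (x i + of_nat (\<gamma> ! i)) * ?F \<gamma> \<alpha>)"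
        by (intro lin_comb_add lin_comb_scale lin_comb_base fin)
      then show "lin_comb (?B (\<beta> ! q)) ?F (\<lambda>\<alpha>. ?y \<alpha> * ?F \<gamma> \<alpha>)"
        unfolding mult_falling_product[OF i(1) len_\<gamma>, where v = "\<gamma> ! q - 1"] .
    qed
    moreover have "lin_comb (?B (\<beta> ! q)) ?F (\<lambda>\<alpha>. (x i + of_nat (\<beta>' ! i)) * ?F \<beta>' \<alpha>)"
      using mem last by (intro lin_comb_scale lin_comb_base fin) auto
    ultimately have "lin_comb (?B (\<beta> ! q)) ?F
        (\<lambda>\<alpha>. ?y \<alpha> * (?P \<beta>' \<alpha> - ?F \<beta>' \<alpha>) + (x i + of_nat (\<beta>' ! i)) * ?F \<beta>' \<alpha>)"
      by (rule lin_comb_add)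
    moreover have "?y \<alpha> * (?P \<beta>' \<alpha> - ?F \<beta>' \<alpha>) + (x i + of_nat (\<beta>' ! i)) * ?F \<beta>' \<alpha>
        = ?P \<beta> \<alpha> - ?F \<beta> \<alpha>" for \<alpha>
    proof -
      have "?P \<beta> \<alpha> = ?P (\<beta>'[i := Suc (\<beta>' ! i)]) \<alpha>"
        by (subst undo[symmetric]) (simp add: shifted_power_def)
      also have "\<dots> = ?y \<alpha> * ?P \<beta>' \<alpha>"
        using i len' by (intro shifted_power_Suc_exponent) auto
      finally show ?thesis
        using mult_falling_product[OF i(1) len', of x \<alpha> "\<beta> ! q"] unfolding undo
        by (simp add: right_diff_distrib)
    qed
    ultimately show ?thesis by simp
  qed
qed

lemma falling_product_diagonal: "falling_product q \<alpha> \<alpha> = of_nat (\<Prod>i<q. fact (\<alpha> ! i))"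
proof -
  have "(\<Prod>k<m. of_nat m - of_nat k) = (of_nat (fact m) :: 'a)" for m :: nat
  proof -
    have "(\<Prod>k<m. of_nat m - of_nat k) = (\<Prod>k<m. of_nat (m - k) :: 'a)"
      by (rule prod.cong) (auto simp: of_nat_diff)
    also have "\<dots> = of_nat (\<Prod>k<m. m - k)" by simp
    also have "(\<Prod>k<m. m - k) = fact m"
      by (simp add: fact_prod_rev atLeast0LessThan)
    finally show ?thesis .
  qed
  then show ?thesis by (simp add: falling_product_def del: of_nat_fact)
qed

lemma falling_product_nonzero_imp_le:
  assumes "falling_product q \<alpha> \<beta> \<noteq> (0 :: 'a::comm_ring_1)" "i < q"
  shows "\<beta> ! i \<le> \<alpha> ! i"
proof (rule ccontr)
  assume "\<not> \<beta> ! i \<le> \<alpha> ! i"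
  then have "(\<Prod>k<\<beta> ! i. of_nat (\<alpha> ! i) - of_nat k) = (0 :: 'a)"
    by (intro prod_zero) auto
  with assms(2) have "falling_product q \<alpha> \<beta> = (0 :: 'a)"
    unfolding falling_product_def by (auto intro: prod_zero)
  with assms(1) show False by contradiction
qed

lemma family_det_shifted_power:
  fixes x :: "nat \<Rightarrow> 'a::comm_ring_1"
  assumes dist: "distinct cs" and cs: "set cs = compositions n (Suc q)"
  shows "family_det cs (\<lambda>\<beta> \<alpha>. shifted_power q x \<alpha> \<beta>) =
    of_nat (\<Prod>\<alpha>\<in>compositions n (Suc q). \<Prod>i<q. fact (\<alpha> ! i))"
proof -
  have le: "\<beta> ! q \<le> n" if "\<beta> \<in> set cs" for \<beta>
    using that compositions_nth_le[of \<beta> n "Suc q" q] cs by simp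
  have "family_det cs (\<lambda>\<beta> \<alpha>. shifted_power q x \<alpha> \<beta>) =
      family_det cs (\<lambda>\<beta> \<alpha>. falling_product q \<alpha> \<beta>)"
  proof (rule family_det_unitriangular_change[OF dist, where r = "\<lambda>\<beta>. n - \<beta> ! q"])
    fix \<beta> assume \<beta>: "\<beta> \<in> set cs"
    have "{\<gamma> \<in> set cs. n - \<gamma> ! q < n - \<beta> ! q} = {\<gamma> \<in> compositions n (Suc q). \<beta> ! q < \<gamma> ! q}"
      using le[OF \<beta>] le by (force simp: cs)
    then show "lin_comb {\<gamma> \<in> set cs. n - \<gamma> ! q < n - \<beta> ! q} (\<lambda>\<beta> \<alpha>. falling_product q \<alpha> \<beta>)
        (\<lambda>\<alpha>. shifted_power q x \<alpha> \<beta> - falling_product q \<alpha> \<beta>)"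
      using newton_expansion \<beta> cs by simp
  qed
  also have "\<dots> = (\<Prod>\<alpha>\<in>set cs. falling_product q \<alpha> \<alpha>)"
  proof (rule family_det_triangular[OF dist, where r = "\<lambda>\<alpha>. \<alpha> ! q"])
    fix \<alpha> \<beta> assume "\<alpha> \<in> set cs" "\<beta> \<in> set cs" and nz: "falling_product q \<alpha> \<beta> \<noteq> (0 :: 'a)"
    then have len: "length \<alpha> = Suc q" "length \<beta> = Suc q"
      and sum: "(\<Sum>i<q. \<alpha> ! i) + \<alpha> ! q = (\<Sum>i<q. \<beta> ! i) + \<beta> ! q"
      by (auto simp: cs mem_compositions)
    have le: "\<beta> ! i \<le> \<alpha> ! i" if "i < q" for i
      using falling_product_nonzero_imp_le[OF nz that] .
    show "\<alpha> = \<beta> \<or> \<alpha> ! q < \<beta> ! q"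
    proof (cases "\<forall>i<q. \<beta> ! i = \<alpha> ! i")
      case True
      with sum have "\<alpha> ! q = \<beta> ! q" by simp
      with True len show ?thesis by (auto intro!: nth_equalityI simp: less_Suc_eq)
    next
      case False
      then have "(\<Sum>i<q. \<beta> ! i) < (\<Sum>i<q. \<alpha> ! i)"
        using le by (intro sum_strict_mono_ex1) (auto simp: order.strict_iff_order)
      with sum show ?thesis by simp
    qed
  qed
  finally show ?thesis by (simp only: falling_product_diagonal cs of_nat_prod)
qed

section \<open>Counting compositions\<close>

lemma card_compositions: "card (compositions n (Suc q)) = (n + q) choose q"
  using card_length_sum_list[of "Suc q" n] binomial_symmetric[of n "n + q"]
  by (simp add: compositions_def)

lemma card_compositions_part_ge:
  assumes "i \<le> q" "j \<le> n"
  shows "card {\<alpha> \<in> compositions n (Suc q). j \<le> \<alpha> ! i} = (n - j + q) choose q"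
proof -
  have "bij_betw (\<lambda>\<alpha>. \<alpha>[i := \<alpha> ! i + j]) (compositions (n - j) (Suc q))
      {\<alpha> \<in> compositions n (Suc q). j \<le> \<alpha> ! i}"
    by (rule bij_betwI[where g = "\<lambda>\<alpha>. \<alpha>[i := \<alpha> ! i - j]"])
      (use assms in \<open>auto simp: compositions_def sum_list_update\<close>)
  from bij_betw_same_card[OF this] show ?thesis
    by (simp add: card_compositions)
qed

lemma sum_parts_compositions:
  "(\<Sum>\<alpha>\<in>compositions n (Suc q). \<alpha> ! q) = (n + q) choose (Suc q)"
proof -
  let ?C = "compositions n (Suc q)"
  \<comment> \<open>A part \<open>a\<close> is the number of \<open>j\<close> in \<open>1..n\<close> with \<open>j \<le> a\<close>; then count pairs the other way.\<close>
  have "\<alpha> ! q = (\<Sum>j = 1..n. if j \<le> \<alpha> ! q then 1 else 0)" if "\<alpha> \<in> ?C" for \<alpha>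
  proof -
    have "{j \<in> {1..n}. j \<le> \<alpha> ! q} = {1..\<alpha> ! q}"
      using compositions_nth_le[OF that, of q] by auto
    then show ?thesis by (simp add: sum.If_cases Collect_conj_eq[symmetric] Int_def)
  qed
  then have "(\<Sum>\<alpha>\<in>?C. \<alpha> ! q) = (\<Sum>\<alpha>\<in>?C. \<Sum>j = 1..n. if j \<le> \<alpha> ! q then 1 else 0)"
    by (rule sum.cong[OF refl])
  also have "\<dots> = (\<Sum>j = 1..n. \<Sum>\<alpha>\<in>?C. if j \<le> \<alpha> ! q then 1 else 0)"
    by (rule sum.swap)
  also have "\<dots> = (\<Sum>j = 1..n. card {\<alpha> \<in> ?C. j \<le> \<alpha> ! q})"
    by (simp add: sum.If_cases finite_compositions Int_def)
  also have "\<dots> = (\<Sum>j = 1..n. (n - j + q) choose q)"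
    by (intro sum.cong refl card_compositions_part_ge) auto
  also have "\<dots> = (\<Sum>m<n. (q + m) choose q)"
    by (rule sum.reindex_bij_witness[where i = "\<lambda>m. n - m" and j = "\<lambda>j. n - j"]) (auto simp: add.commute)
  also have "\<dots> = (n + q) choose (Suc q)"
  proof (cases n)
    case (Suc m)
    then show ?thesis
      using choose_rising_sum(1)[of q m] by (simp add: lessThan_Suc_atMost add.commute)
  qed simp
  finally show ?thesis .
qed

lemma prod_fact_parts_compositions:
  "(\<Prod>\<alpha>\<in>compositions n (Suc q). \<Prod>i<q. fact (\<alpha> ! i)) =
    (\<Prod>j = 1..n. j ^ (q * ((n - j + q) choose q)) :: nat)"
proof -
  let ?C = "compositions n (Suc q)"
  have "fact (\<alpha> ! i) = (\<Prod>j = 1..n. if j \<le> \<alpha> ! i then j else 1)" if "\<alpha> \<in> ?C" "i < q" for \<alpha> i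
  proof -
    have "{j \<in> {1..n}. j \<le> \<alpha> ! i} = {1..\<alpha> ! i}"
      using compositions_nth_le[OF that(1), of i] that(2) by auto
    then show ?thesis by (simp add: prod.If_cases Int_def fact_prod)
  qed
  then have "(\<Prod>\<alpha>\<in>?C. \<Prod>i<q. fact (\<alpha> ! i)) =
      (\<Prod>\<alpha>\<in>?C. \<Prod>i<q. \<Prod>j = 1..n. if j \<le> \<alpha> ! i then j else 1)"
    by (intro prod.cong refl) auto
  also have "\<dots> = (\<Prod>i<q. \<Prod>j = 1..n. \<Prod>\<alpha>\<in>?C. if j \<le> \<alpha> ! i then j else 1)"
    by (subst prod.swap, subst prod.swap) (rule refl)
  also have "\<dots> = (\<Prod>i<q. \<Prod>j = 1..n. j ^ card {\<alpha> \<in> ?C. j \<le> \<alpha> ! i})"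
    by (simp add: prod.If_cases finite_compositions Int_def)
  also have "\<dots> = (\<Prod>i<q. \<Prod>j = 1..n. j ^ ((n - j + q) choose q))"
    by (intro prod.cong refl) (simp add: card_compositions_part_ge)
  also have "\<dots> = (\<Prod>j = 1..n. j ^ (q * ((n - j + q) choose q)))"
    by (simp add: prod_power_distrib power_mult[symmetric] mult.commute)
  finally show ?thesis .
qed

section \<open>The composition determinant\<close>

theorem Delta_compositions:
  fixes x :: "nat \<Rightarrow> 'a::comm_ring_1"
  assumes "distinct cs" and cs: "set cs = compositions n (Suc q)"
  shows "Delta cs (Suc q) x =
    ((\<Sum>i<Suc q. x i) + of_nat n) ^ ((n + q) choose (Suc q)) *
    (\<Prod>j = 1..n. of_nat j ^ (q * ((n - j + q) choose q)))"
proof -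
  let ?t = "(\<Sum>i<Suc q. x i) + of_nat n"
  have "Delta cs (Suc q) x = family_det cs (\<lambda>\<beta> \<alpha>. shifted_power (Suc q) x \<alpha> \<beta>)"
    by (simp add: Delta_def family_det_def)
  also have "\<dots> = family_det cs
      (\<lambda>\<beta> \<alpha>. (\<Sum>i<Suc q. x i + of_nat (\<alpha> ! i)) ^ (\<beta> ! q) * shifted_power q x \<alpha> \<beta>)"
    by (rule family_det_sum_of_variables[OF assms])
  also have "\<dots> = family_det cs (\<lambda>\<beta> \<alpha>. ?t ^ (\<beta> ! q) * shifted_power q x \<alpha> \<beta>)"
  proof (rule family_det_cong)
    fix \<alpha> \<beta> assume "\<alpha> \<in> set cs"
    then have "(\<Sum>i<Suc q. \<alpha> ! i) = n" using cs mem_compositions by blast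
    then have "(\<Sum>i<Suc q. x i + of_nat (\<alpha> ! i)) = ?t"
      by (simp only: sum.distrib of_nat_sum[symmetric])
    then show "(\<Sum>i<Suc q. x i + of_nat (\<alpha> ! i)) ^ (\<beta> ! q) * shifted_power q x \<alpha> \<beta> =
        ?t ^ (\<beta> ! q) * shifted_power q x \<alpha> \<beta>" by (simp only:)
  qed
  also have "\<dots> = (\<Prod>\<beta>\<in>set cs. ?t ^ (\<beta> ! q)) * family_det cs (\<lambda>\<beta> \<alpha>. shifted_power q x \<alpha> \<beta>)"
    by (rule family_det_scale_columns[OF assms(1)])
  also have "(\<Prod>\<beta>\<in>set cs. ?t ^ (\<beta> ! q)) = ?t ^ ((n + q) choose (Suc q))"
    by (simp only: power_sum[symmetric] cs sum_parts_compositions)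
  also have "family_det cs (\<lambda>\<beta> \<alpha>. shifted_power q x \<alpha> \<beta>) =
      (\<Prod>j = 1..n. of_nat j ^ (q * ((n - j + q) choose q)))"
    by (simp only: family_det_shifted_power[OF assms] prod_fact_parts_compositions
        of_nat_prod of_nat_power)
  finally show ?thesis .
qed

theorem theorem5p1:
  fixes n p :: nat and cs :: "nat list list"
  assumes "p \<ge> 1"
    and "distinct cs" and "set cs = compositions n p"
  shows "Delta cs p Var =
    ((\<Sum>i<p. Var i) + of_nat n) ^ ((n + p - 1) choose p) *
    (\<Prod>i=1..n. of_nat i ^ ((p - 1) * ((n + p - i - 1) choose (p - 1))))"
proof -
  obtain q where p: "p = Suc q" using assms(1) by (cases p) auto
  have "(\<Prod>i=1..n. of_nat i ^ ((p - 1) * ((n + p - i - 1) choose (p - 1))) :: int_mpoly) =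
      (\<Prod>i=1..n. of_nat i ^ (q * ((n - i + q) choose q)))"
    by (rule prod.cong) (auto simp: p)
  with Delta_compositions[OF assms(2), of n q Var] assms(3) show ?thesis
    by (simp add: p)
qed

end
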